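(* Let $\rho,l,k_0,c_0>0$, $T_0>0$, $T_f<T_0$, $\delta\ge 0$, $p\ge 0$, and put $a=\sqrt{k_0/(\rho c_0)}$, $\mathrm{Ste}=c_0(T_0-T_f)/l$. The one-phase Stefan problem with Dirichlet condition (find $T=T(x,t)$ and $x=s(t)$) $$\rho\, c(T)\frac{\partial T}{\partial t}=\frac{\partial}{\partial x}\Big(k(T)\frac{\partial T}{\partial x}\Big),\quad 0<x<s(t),\ t>0,$$ $$T(0,t)=T_0,\qquad T(s(t),t)=T_f,\qquad k_0\frac{\partial T}{\partial x}(s(t),t)=-\rho\, l\,\dot s(t),\quad t>0,\qquad s(0)=0,$$ has a unique similarity type solution, and it is given by $$T(x,t)=(T_0-T_f)\,y\Big(\frac{x}{2a\sqrt t}\Big)+T_f,\quad 0<x<s(t),\ t>0,\qquad s(t)=2a\lambda\sqrt t,\quad t>0,$$ where $(y,\lambda)$, with $\lambda>0$ and $y\ge 0$, is the unique solution to the functional problem $$\lambda\exp(\lambda^2)\,\mathrm{erf}(\lambda)=\frac{\mathrm{Ste}}{\sqrt\pi}\Big(1+\frac{\delta}{p+1}\Big),$$ $$y(\eta)+\frac{\delta}{p+1}\,y^{p+1}(\eta)=\frac{\sqrt\pi}{\mathrm{Ste}}\,\lambda\exp(\lambda^2)\big(\mathrm{erf}(\lambda)-\mathrm{erf}(\eta)\big),\quad 0<\eta<\lambda.$$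
   Context: The thermal conductivity and specific heat are $$k(T)=k_0\Big(1+\delta\Big(\frac{T-T_f}{T_0-T_f}\Big)^p\Big),\qquad c(T)=c_0\Big(1+\delta\Big(\frac{T-T_f}{T_0-T_f}\Big)^p\Big),$$ where $k_0=k(T_f)$ and $c_0=c(T_f)$ are the reference thermal conductivity and specific heat. $\rho$ is the density, $l$ the latent heat per unit mass, $T_0$ the temperature at the fixed face $x=0$, $T_f$ the phase change temperature. A similarity type solution is a solution $(T,s)$ (equations understood in the classical sense) of the form $T(x,t)=(T_0-T_f)\,y(\eta)+T_f$ with $\eta=x/(2a\sqrt t)$ and $s(t)=2a\lambda\sqrt t$, for some parameter $\lambda>0$ and some function $y\ge 0$ of the single variable $\eta\in[0,\lambda]$. Here $\mathrm{erf}(x)=\frac{2}{\sqrt\pi}\int_0^x e^{-u^2}\,du$. *)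

theory Defs
  imports "HOL-Analysis.Analysis"
begin

(* The oriented integral, so that erf is correct for negative arguments too. *)
definition erf :: "real \<Rightarrow> real" where
  "erf x = 2 / sqrt pi * (LBINT u=0..x. exp (- (u\<^sup>2)))"

(* The library has 0 powr 0 = 0; in the material law z^p with p = 0 is the constant 1.
   With this convention k(T_f) = k_0 holds for p > 0, and for p = 0 only if delta = 0. *)
definition rpow :: "real \<Rightarrow> real \<Rightarrow> real" where
  "rpow z p = (if p = 0 then 1 else z powr p)"

(* The common form of k(T) and c(T), with reference value r (k_0 or c_0). *)
definition thermal_law :: "real \<Rightarrow> real \<Rightarrow> real \<Rightarrow> real \<Rightarrow> real \<Rightarrow> real \<Rightarrow> real" where
  "thermal_law r \<delta> p T0 Tf T = r * (1 + \<delta> * rpow ((T - Tf) / (T0 - Tf)) p)"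

(* Only the values of T on 0 <= x <= s(t), t > 0 matter; hence the derivative in x is taken
   within {0..s t}: it is the ordinary one for 0 < x < s t and the left one on the free boundary.
   Every derivative occurring in the problem is required to exist and to be continuous; the
   heat flux derivative is so because it equals rho * c(T) * T_t. *)
definition stefan_solution ::
  "real \<Rightarrow> real \<Rightarrow> real \<Rightarrow> (real \<Rightarrow> real) \<Rightarrow> (real \<Rightarrow> real) \<Rightarrow> real \<Rightarrow> real
    \<Rightarrow> (real \<Rightarrow> real \<Rightarrow> real) \<Rightarrow> (real \<Rightarrow> real) \<Rightarrow> bool" where
  "stefan_solution \<rho> l k0 k c T0 Tf T s \<longleftrightarrow>
     s 0 = 0 \<and> continuous_on {0..} s \<and> (\<forall>t>0. s t > 0) \<and>
     continuous_on {(x, t). 0 < t \<and> 0 \<le> x \<and> x \<le> s t} (\<lambda>(x, t). T x t) \<and>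
     (\<exists>Tt Tx s'.
        continuous_on {(x, t). 0 < t \<and> 0 < x \<and> x < s t} (\<lambda>(x, t). Tt x t) \<and>
        continuous_on {(x, t). 0 < t \<and> 0 < x \<and> x \<le> s t} (\<lambda>(x, t). Tx x t) \<and>
        continuous_on {0<..} s' \<and>
        (\<forall>t>0.
           (s has_real_derivative s' t) (at t) \<and>
           (\<forall>x. 0 < x \<and> x \<le> s t \<longrightarrow>
              ((\<lambda>\<xi>. T \<xi> t) has_real_derivative Tx x t) (at x within {0..s t})) \<and>
           (\<forall>x. 0 < x \<and> x < s t \<longrightarrow>
              ((\<lambda>\<tau>. T x \<tau>) has_real_derivative Tt x t) (at t) \<and>
              ((\<lambda>\<xi>. k (T \<xi> t) * Tx \<xi> t) has_real_derivative \<rho> * c (T x t) * Tt x t) (at x)) \<and>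
           T 0 t = T0 \<and>
           T (s t) t = Tf \<and>
           k0 * Tx (s t) t = - \<rho> * l * s' t))"

definition similarity_form ::
  "real \<Rightarrow> real \<Rightarrow> real \<Rightarrow> (real \<Rightarrow> real \<Rightarrow> real) \<Rightarrow> (real \<Rightarrow> real) \<Rightarrow> bool" where
  "similarity_form a T0 Tf T s \<longleftrightarrow>
     (\<exists>lam y. lam > 0 \<and> (\<forall>\<eta>\<in>{0..lam}. y \<eta> \<ge> 0) \<and>
        (\<forall>t>0. s t = 2 * a * lam * sqrt t) \<and>
        (\<forall>t>0. \<forall>x\<in>{0..s t}. T x t = (T0 - Tf) * y (x / (2 * a * sqrt t)) + Tf))"

definition similarity_solution ::
  "real \<Rightarrow> real \<Rightarrow> real \<Rightarrow> (real \<Rightarrow> real) \<Rightarrow> (real \<Rightarrow> real) \<Rightarrow> real \<Rightarrow> real \<Rightarrow> real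
    \<Rightarrow> (real \<Rightarrow> real \<Rightarrow> real) \<Rightarrow> (real \<Rightarrow> real) \<Rightarrow> bool" where
  "similarity_solution \<rho> l k0 k c a T0 Tf T s \<longleftrightarrow>
     stefan_solution \<rho> l k0 k c T0 Tf T s \<and> similarity_form a T0 Tf T s"

definition functional_problem ::
  "real \<Rightarrow> real \<Rightarrow> real \<Rightarrow> (real \<Rightarrow> real) \<Rightarrow> real \<Rightarrow> bool" where
  "functional_problem Ste \<delta> p y lam \<longleftrightarrow>
     lam > 0 \<and> (\<forall>\<eta>\<in>{0..lam}. y \<eta> \<ge> 0) \<and>
     lam * exp (lam\<^sup>2) * erf lam = Ste / sqrt pi * (1 + \<delta> / (p + 1)) \<and>
     (\<forall>\<eta>. 0 < \<eta> \<and> \<eta> < lam \<longrightarrow>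
        y \<eta> + \<delta> / (p + 1) * y \<eta> powr (p + 1)
          = sqrt pi / Ste * lam * exp (lam\<^sup>2) * (erf lam - erf \<eta>))"

end

theory Submission
  imports Defs
begin

text \<open>Let $z = (T - T_f)/(T_0 - T_f)$. Conductivity and specific heat carry the same factor
$D(z) = 1 + \delta z^p$, so for $T = (T_0 - T_f)\,y(\eta) + T_f$, $\eta = x/(2a\sqrt t)$, the heat
equation becomes $(D(y)\,y')' = -2\eta\,D(y)\,y'$. This is a linear equation of first order for
the flux $w = D(y)\,y'$, hence $w = -C e^{-\eta^2}$. The Stefan condition at $\eta = \lambda$
determines $C = 2\lambda e^{\lambda^2}/\mathrm{Ste}$. On the other hand
$w = (\Psi(y))'$ for the Kirchhoff transform $\Psi(z) = z + \delta z^{p+1}/(p+1)$, so a second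
integration, from $\eta$ to $\lambda$ where $y = 0$, gives
$$\Psi(y(\eta)) = \frac{\sqrt\pi}{\mathrm{Ste}}\,\lambda e^{\lambda^2}
  (\mathrm{erf}\,\lambda - \mathrm{erf}\,\eta),$$
and $y(0) = 1$ turns its value at $\eta = 0$ into the equation for $\lambda$. Thus every
similarity solution yields a solution of the functional problem
(\<open>similarity_solution_imp_functional_problem\<close>).

The functional problem is uniquely solvable because $\lambda e^{\lambda^2}\mathrm{erf}\,\lambda$
increases strictly from $0$ to $\infty$ (\<open>transcendental_unique_root\<close>) and $\Psi$ is
injective. For existence, \<open>profile\<close> inverts $\Psi$ and \<open>similarity_solution_temperature\<close>
checks the Stefan problem. The classical derivatives are available up to the free boundary
because $\Psi' = D \ge 1$, so that the inverse of $\Psi$ is continuously differentiable.\<close>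

section \<open>The error function\<close>

lemma erf_has_real_derivative [derivative_intros]:
  "(erf has_real_derivative 2 / sqrt pi * exp (- (x\<^sup>2))) (at x)"
proof -
  \<comment> \<open>An interval that contains both $0$ and $x$, as the fundamental
    theorem of calculus needs for the oriented integral.\<close>
  define A where "A = - \<bar>x\<bar> - 1"
  define B where "B = \<bar>x\<bar> + 1"
  have AB: "A \<le> 0" "0 \<le> B" "A < x" "x < B"
    by (auto simp: A_def B_def)
  have "((\<lambda>u. LBINT v=0..u. exp (- (v\<^sup>2))) has_vector_derivative exp (- (x\<^sup>2))) (at x within {A..B})"
    unfolding zero_ereal_def using AB
    by (intro interval_integral_FTC2 continuous_intros) auto
  moreover have "at x within {A..B} = at x"
    using AB by (intro at_within_interior) (auto simp: interior_atLeastAtMost_real)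
  ultimately have "((\<lambda>u. LBINT v=0..u. exp (- (v\<^sup>2))) has_real_derivative exp (- (x\<^sup>2))) (at x)"
    by (simp add: has_real_derivative_iff_has_vector_derivative)
  from DERIV_cmult[OF this, of "2 / sqrt pi"] show ?thesis
    by (simp add: erf_def[abs_def])
qed

lemma erf_0 [simp]: "erf 0 = 0"
  by (simp add: erf_def zero_ereal_def)

lemma erf_strict_mono: "x < y \<Longrightarrow> erf x < erf y"
proof (rule DERIV_pos_imp_increasing[of x y erf])
  show "\<exists>d. (erf has_real_derivative d) (at u) \<and> d > 0" for u
    by (intro exI conjI, rule erf_has_real_derivative) simp
qed

lemma continuous_on_erf [continuous_intros]:
  "continuous_on S f \<Longrightarrow> continuous_on S (\<lambda>x. erf (f x))"
  by (rule continuous_on_compose2[of UNIV])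
     (auto intro: DERIV_continuous_on erf_has_real_derivative)

text \<open>For $x > 0$ the left-hand side is a product of three increasing positive factors. It vanishes at $0$ and is
at least $x\,\mathrm{erf}\,1$ for $x \ge 1$, so it attains $K$ somewhere in
$[0, \max(1, K/\mathrm{erf}\,1)]$.\<close>

lemma transcendental_unique_root:
  fixes K :: real
  assumes "K > 0"
  shows "\<exists>!x. x > 0 \<and> x * exp (x\<^sup>2) * erf x = K"
proof -
  define h where "h x = x * exp (x\<^sup>2) * erf x" for x :: real
  have erf_pos: "erf x > 0" if "x > 0" for x
    using erf_strict_mono[OF that] by simp
  have mono: "h x < h y" if "0 < x" "x < y" for x y
    unfolding h_def using that erf_pos[of x] erf_strict_mono[of x y]
    by (intro mult_strict_mono mult_pos_pos) (auto intro!: power_strict_mono)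
  have cont: "continuous_on S h" for S
    unfolding h_def by (intro continuous_intros)
  define M where "M = max 1 (K / erf 1)"
  have M: "M \<ge> 1" "K \<le> M * erf 1"
    using erf_pos[of 1] by (auto simp: M_def max_def field_simps)
  have "M * 1 * erf 1 \<le> h M"
    unfolding h_def using M erf_pos[of 1] erf_strict_mono[of 1 M]
    by (intro mult_mono) (auto simp: order_le_less)
  then have "K \<le> h M"
    using M by simp
  moreover have "h 0 = 0"
    by (simp add: h_def)
  ultimately obtain x where x: "0 \<le> x" "h x = K"
    using IVT'[of h 0 K M] cont assms M by auto
  with \<open>h 0 = 0\<close> assms have "x > 0"
    by (cases "x = 0") auto
  show ?thesis
    unfolding h_def[symmetric]
  proof (rule ex1I[of _ x])
    show "x > 0 \<and> h x = K"
      using \<open>x > 0\<close> x by simp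
    show "z = x" if "z > 0 \<and> h z = K" for z
      using mono[of x z] mono[of z x] that \<open>x > 0\<close> x by (cases z x rule: linorder_cases) auto
  qed
qed

section \<open>The Kirchhoff transform\<close>

text \<open>For $p > 0$ the truncation at $0$ agrees with the factor $1 + \delta z^p$ of the material law on
$z \ge 0$ and extends it continuously by $1$ to $z < 0$.\<close>

definition conductivity :: "real \<Rightarrow> real \<Rightarrow> real \<Rightarrow> real" where
  "conductivity \<delta> p z = 1 + \<delta> * max 0 z powr p"

text \<open>The antiderivative of \<^const>\<open>conductivity\<close> that vanishes at $0$. As it is the identity on
$z \le 0$, for $p > 0$ it is a $C^1$ diffeomorphism of the whole line. The temperature profile defined from
its inverse is then differentiable at the free boundary from both sides.\<close>

definition kirchhoff :: "real \<Rightarrow> real \<Rightarrow> real \<Rightarrow> real" where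
  "kirchhoff \<delta> p z = z + \<delta> / (p + 1) * max 0 z powr (p + 1)"

text \<open>For $p = 0$ the truncated power jumps at $0$. The last assumption is what the normalisation
$k(T_f) = k_0$ forces in this case, since the material law has the constant value
$k_0(1 + \delta)$.\<close>

locale power_law =
  fixes \<delta> p :: real
  assumes \<delta>_nonneg: "\<delta> \<ge> 0" and p_nonneg: "p \<ge> 0" and p_0_imp: "p = 0 \<Longrightarrow> \<delta> = 0"
begin

abbreviation D :: "real \<Rightarrow> real" where "D \<equiv> conductivity \<delta> p"
abbreviation \<Psi> :: "real \<Rightarrow> real" where "\<Psi> \<equiv> kirchhoff \<delta> p"

lemma conductivity_ge_1: "D z \<ge> 1"
  using \<delta>_nonneg by (simp add: conductivity_def)

lemma conductivity_0 [simp]: "D 0 = 1"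
  by (simp add: conductivity_def)

lemma thermal_law_conv_conductivity:
  assumes "Tf < T0" "z \<ge> 0"
  shows "thermal_law r \<delta> p T0 Tf ((T0 - Tf) * z + Tf) = r * D z"
  using assms p_0_imp by (auto simp: thermal_law_def rpow_def conductivity_def)

lemma continuous_on_conductivity [continuous_intros]:
  assumes "continuous_on S f"
  shows "continuous_on S (\<lambda>x. D (f x))"
proof (cases "p = 0")
  case True
  then show ?thesis
    using p_0_imp by (simp add: conductivity_def)
next
  case False
  then show ?thesis
    unfolding conductivity_def using p_nonneg assms
    by (intro continuous_intros continuous_on_powr') auto
qed

lemma kirchhoff_0 [simp]: "\<Psi> 0 = 0"
  by (simp add: kirchhoff_def)

lemma kirchhoff_1: "\<Psi> 1 = 1 + \<delta> / (p + 1)"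
  by (simp add: kirchhoff_def)

lemma kirchhoff_of_nonneg:
  "z \<ge> 0 \<Longrightarrow> \<Psi> z = z + \<delta> / (p + 1) * z powr (p + 1)"
  by (simp add: kirchhoff_def max_def)

text \<open>Only $z = 0$ needs an argument: there the difference quotient of the truncated power is bounded
by $|h|^p$, which tends to $0$ for $p > 0$.\<close>

lemma kirchhoff_has_real_derivative:
  "(\<Psi> has_real_derivative D z) (at z)"
proof (cases "p = 0")
  case True
  then have "\<Psi> = (\<lambda>z. z)" "D z = 1"
    using p_0_imp by (auto simp: kirchhoff_def conductivity_def)
  then show ?thesis
    by simp
next
  case False
  with p_nonneg have p: "p > 0" by simp
  have "((\<lambda>z. max 0 z powr (p + 1)) has_real_derivative (p + 1) * max 0 z powr p) (at z)"
  proof (cases z "0 :: real" rule: linorder_cases)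
    case less
    have "((\<lambda>z. 0) has_real_derivative (p + 1) * max 0 z powr p) (at z)"
      using less by (simp add: max_def)
    then show ?thesis
      by (rule has_field_derivative_transform_within_open[where S = "{..<0}"])
         (use less in \<open>auto simp: max_def\<close>)
  next
    case equal
    have "((\<lambda>h. \<bar>h\<bar> powr p) \<longlongrightarrow> 0) (at (0::real))"
      using p by (intro tendsto_zero_powrI[of _ _ "\<lambda>_. p" p]) (auto intro: tendsto_rabs_zero)
    then have "((\<lambda>h. max 0 h powr (p + 1) / h) \<longlongrightarrow> 0) (at (0::real))"
    proof (rule Lim_null_comparison[rotated], intro always_eventually allI)
      show "norm (max 0 h powr (p + 1) / h) \<le> \<bar>h\<bar> powr p" for h :: real
        by (cases "h > 0") (auto simp: powr_add max_def)
    qed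
    then show ?thesis
      using equal by (simp add: DERIV_def)
  next
    case greater
    have "((\<lambda>z. z powr (p + 1)) has_real_derivative (p + 1) * max 0 z powr p) (at z)"
      using greater by (auto intro!: derivative_eq_intros simp: max_def)
    then show ?thesis
      by (rule has_field_derivative_transform_within_open[where S = "{0<..}"])
         (use greater in \<open>auto simp: max_def\<close>)
  qed
  from DERIV_add[OF DERIV_ident DERIV_cmult[OF this, of "\<delta> / (p + 1)"]] show ?thesis
    using p by (simp add: kirchhoff_def[abs_def] conductivity_def)
qed

lemma continuous_on_kirchhoff [continuous_intros]:
  "continuous_on S f \<Longrightarrow> continuous_on S (\<lambda>x. \<Psi> (f x))"
  by (rule continuous_on_compose2[of UNIV])
     (auto intro: DERIV_continuous_on kirchhoff_has_real_derivative)

lemma kirchhoff_strict_mono: "strict_mono \<Psi>"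
proof (rule strict_monoI)
  show "\<Psi> x < \<Psi> z" if "x < z" for x z
    using that
  proof (rule DERIV_pos_imp_increasing)
    show "\<exists>d. (\<Psi> has_real_derivative d) (at u) \<and> d > 0" for u
      using kirchhoff_has_real_derivative[of u] conductivity_ge_1[of u]
      by (intro exI[of _ "D u"]) simp
  qed
qed

lemma kirchhoff_surj: "surj \<Psi>"
proof -
  have "\<exists>z. v = \<Psi> z" for v
  proof (cases "v \<ge> 0")
    case True
    have "v \<le> \<Psi> v"
      using True \<delta>_nonneg p_nonneg by (simp add: kirchhoff_def)
    then show ?thesis
      using IVT'[of \<Psi> 0 v v] True continuous_on_kirchhoff[OF continuous_on_id] by auto
  next
    case False
    then show ?thesis
      by (intro exI[of _ v]) (simp add: kirchhoff_def max_def)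
  qed
  then show ?thesis
    by (simp add: surj_def)
qed

lemma bij_kirchhoff: "bij \<Psi>"
  using kirchhoff_strict_mono kirchhoff_surj by (simp add: bij_def strict_mono_imp_inj_on)

lemma kirchhoff_inv [simp]: "\<Psi> (inv \<Psi> v) = v"
  by (simp add: kirchhoff_surj surj_f_inv_f)

lemma inv_kirchhoff_kirchhoff [simp]: "inv \<Psi> (\<Psi> z) = z"
  by (simp add: bij_kirchhoff bij_is_inj)

lemma inv_kirchhoff_has_real_derivative:
  "(inv \<Psi> has_real_derivative inverse (D (inv \<Psi> v))) (at v)"
proof (rule DERIV_inverse_function[where f = \<Psi> and a = "v - 1" and b = "v + 1"])
  show "(\<Psi> has_real_derivative D (inv \<Psi> v)) (at (inv \<Psi> v))"
    by (rule kirchhoff_has_real_derivative)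
  show "D (inv \<Psi> v) \<noteq> 0"
    using conductivity_ge_1[of "inv \<Psi> v"] by linarith
  have "isCont (inv \<Psi>) (\<Psi> (inv \<Psi> v))"
    by (rule isCont_inverse_function[of 1])
       (auto intro: DERIV_isCont kirchhoff_has_real_derivative)
  then show "isCont (inv \<Psi>) v"
    by simp
qed auto

section \<open>The functional problem\<close>

text \<open>The explicit solution of the second equation of the functional problem for a given $\lambda$. It
is defined for all real $\eta$; for positive $\mathrm{Ste}$ and $\lambda$ it is negative
beyond $\lambda$.\<close>

definition profile :: "real \<Rightarrow> real \<Rightarrow> real \<Rightarrow> real" where
  "profile Ste lam \<eta> = inv \<Psi> (sqrt pi / Ste * lam * exp (lam\<^sup>2) * (erf lam - erf \<eta>))"

definition profile_slope :: "real \<Rightarrow> real \<Rightarrow> real \<Rightarrow> real" where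
  "profile_slope Ste lam \<eta> =
     - (2 / Ste * lam * exp (lam\<^sup>2)) * exp (- (\<eta>\<^sup>2)) / D (profile Ste lam \<eta>)"

lemma profile_has_real_derivative:
  "(profile Ste lam has_real_derivative profile_slope Ste lam \<eta>) (at \<eta>)"
proof -
  have "((\<lambda>\<eta>. sqrt pi / Ste * lam * exp (lam\<^sup>2) * (erf lam - erf \<eta>)) has_real_derivative
          - (2 / Ste * lam * exp (lam\<^sup>2)) * exp (- (\<eta>\<^sup>2))) (at \<eta>)"
    by (cases "Ste = 0") (auto intro!: derivative_eq_intros)
  from DERIV_chain2[OF inv_kirchhoff_has_real_derivative this] show ?thesis
    by (simp add: profile_def[abs_def] profile_slope_def divide_inverse mult_ac)
qed

lemma profile_flux:
  "D (profile Ste lam \<eta>) * profile_slope Ste lam \<eta> = - (2 / Ste * lam * exp (lam\<^sup>2)) * exp (- (\<eta>\<^sup>2))"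
  using conductivity_ge_1[of "profile Ste lam \<eta>"] by (simp add: profile_slope_def)

lemma continuous_on_profile [continuous_intros]:
  "continuous_on S f \<Longrightarrow> continuous_on S (\<lambda>x. profile Ste lam (f x))"
  by (rule continuous_on_compose2[of UNIV])
     (auto intro: DERIV_continuous_on profile_has_real_derivative)

lemma continuous_on_profile_slope [continuous_intros]:
  assumes "continuous_on S f"
  shows "continuous_on S (\<lambda>x. profile_slope Ste lam (f x))"
proof -
  have "D z \<noteq> 0" for z
    using conductivity_ge_1[of z] by linarith
  then show ?thesis
    unfolding profile_slope_def using assms by (intro continuous_intros) auto
qed

lemma profile_end: "profile Ste lam lam = 0"
  using inv_kirchhoff_kirchhoff[of 0] by (simp add: profile_def)

lemma profile_nonneg:
  assumes "Ste > 0" "lam > 0" "\<eta> \<le> lam"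
  shows "profile Ste lam \<eta> \<ge> 0"
proof -
  have "erf \<eta> \<le> erf lam"
    using assms(3) erf_strict_mono[of \<eta> lam] by (cases "\<eta> = lam") auto
  then have "\<Psi> 0 \<le> \<Psi> (profile Ste lam \<eta>)"
    unfolding profile_def kirchhoff_inv using assms by simp
  then show ?thesis
    using kirchhoff_strict_mono strict_mono_less_eq by blast
qed

lemma functional_problem_profile:
  assumes "Ste > 0" "lam > 0"
    and "lam * exp (lam\<^sup>2) * erf lam = Ste / sqrt pi * (1 + \<delta> / (p + 1))"
  shows "functional_problem Ste \<delta> p (profile Ste lam) lam"
  unfolding functional_problem_def
proof (intro conjI ballI allI impI)
  show "profile Ste lam \<eta> \<ge> 0" if "\<eta> \<in> {0..lam}" for \<eta>
    using that assms by (intro profile_nonneg) auto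
  show "profile Ste lam \<eta> + \<delta> / (p + 1) * profile Ste lam \<eta> powr (p + 1)
      = sqrt pi / Ste * lam * exp (lam\<^sup>2) * (erf lam - erf \<eta>)" if "0 < \<eta> \<and> \<eta> < lam" for \<eta>
  proof -
    have "profile Ste lam \<eta> \<ge> 0"
      using that assms by (intro profile_nonneg) auto
    from kirchhoff_of_nonneg[OF this, symmetric] show ?thesis
      by (simp add: profile_def)
  qed
qed (use assms in auto)

lemma functional_problem_imp_profile:
  assumes "functional_problem Ste \<delta> p y lam" "0 < \<eta>" "\<eta> < lam"
  shows "y \<eta> = profile Ste lam \<eta>"
proof -
  have "\<Psi> (y \<eta>) = sqrt pi / Ste * lam * exp (lam\<^sup>2) * (erf lam - erf \<eta>)"
    using assms kirchhoff_of_nonneg[of "y \<eta>"] by (auto simp: functional_problem_def)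
  then show ?thesis
    by (metis inv_kirchhoff_kirchhoff profile_def)
qed

lemma functional_problem_unique_lam:
  assumes "Ste > 0" "functional_problem Ste \<delta> p y lam" "functional_problem Ste \<delta> p y' lam'"
  shows "lam' = lam"
proof -
  have "Ste / sqrt pi * (1 + \<delta> / (p + 1)) > 0"
    using assms \<delta>_nonneg p_nonneg by (intro mult_pos_pos add_pos_nonneg) auto
  from transcendental_unique_root[OF this] assms show ?thesis
    unfolding functional_problem_def by blast
qed

text \<open>The two integrations: $D(y)\,y' e^{\eta^2}$ is constant by the differential equation, with
its value read off at the free boundary; then
$\Psi(y) + \frac{\sqrt\pi}{2} C\,\mathrm{erf}$ is constant. Differentiability is assumed only in
the open interval, so the boundary values enter through continuity: $y'$ is continuous up to
$\lambda$, whereas at $0$ only $y$ itself is assumed to be.\<close>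

lemma free_boundary_ode_imp_functional_problem:
  assumes "Ste > 0" "lam > 0"
    and nonneg: "\<And>\<eta>. \<eta> \<in> {0..lam} \<Longrightarrow> y \<eta> \<ge> 0"
    and cont: "continuous_on {0..lam} y" "continuous_on {0<..lam} y1"
    and deriv: "\<And>\<eta>. 0 < \<eta> \<Longrightarrow> \<eta> < lam \<Longrightarrow> (y has_real_derivative y1 \<eta>) (at \<eta>)"
    and ode: "\<And>\<eta>. 0 < \<eta> \<Longrightarrow> \<eta> < lam \<Longrightarrow>
      ((\<lambda>\<xi>. D (y \<xi>) * y1 \<xi>) has_real_derivative - 2 * \<eta> * (D (y \<eta>) * y1 \<eta>)) (at \<eta>)"
    and bc: "y 0 = 1" "y lam = 0" "y1 lam = - 2 * lam / Ste"
  shows "functional_problem Ste \<delta> p y lam"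
proof -
  define C where "C = 2 / Ste * lam * exp (lam\<^sup>2)"
  have flux: "D (y \<eta>) * y1 \<eta> = - C * exp (- (\<eta>\<^sup>2))" if \<eta>: "0 < \<eta>" "\<eta> < lam" for \<eta>
  proof -
    define F where "F \<xi> = D (y \<xi>) * y1 \<xi> * exp (\<xi>\<^sup>2)" for \<xi>
    have "F lam = F \<eta>"
    proof (rule DERIV_isconst_end[OF \<eta>(2)])
      show "continuous_on {\<eta>..lam} F"
        unfolding F_def using \<eta>
        by (intro continuous_intros continuous_on_subset[OF cont(1)] continuous_on_subset[OF cont(2)])
           auto
      show "(F has_real_derivative 0) (at x)" if "\<eta> < x" "x < lam" for x
      proof -
        have "(F has_real_derivative
            (- 2 * x * (D (y x) * y1 x)) * exp (x\<^sup>2) + (exp (x\<^sup>2) * (2 * x)) * (D (y x) * y1 x)) (at x)"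
          unfolding F_def using that \<eta>
          by (intro DERIV_mult[OF ode]) (auto intro!: derivative_eq_intros)
        then show ?thesis
          by (simp add: algebra_simps)
      qed
    qed
    then have "D (y \<eta>) * y1 \<eta> * exp (\<eta>\<^sup>2) = - C"
      using bc by (simp add: F_def C_def)
    then show ?thesis
      by (simp add: exp_minus field_simps)
  qed
  have integrated: "\<Psi> (y \<eta>) = sqrt pi / Ste * lam * exp (lam\<^sup>2) * (erf lam - erf \<eta>)"
    if \<eta>: "0 \<le> \<eta>" "\<eta> < lam" for \<eta>
  proof -
    define F where "F \<xi> = \<Psi> (y \<xi>) + sqrt pi / 2 * C * erf \<xi>" for \<xi>
    have "F lam = F \<eta>"
    proof (rule DERIV_isconst_end[OF \<eta>(2)])
      show "continuous_on {\<eta>..lam} F"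
        unfolding F_def using \<eta>
        by (intro continuous_intros continuous_on_subset[OF cont(1)]) auto
      show "(F has_real_derivative 0) (at x)" if "\<eta> < x" "x < lam" for x
      proof -
        have "0 < x"
          using \<eta> that by simp
        have "(F has_real_derivative
            D (y x) * y1 x + sqrt pi / 2 * C * (2 / sqrt pi * exp (- (x\<^sup>2)))) (at x)"
          unfolding F_def using \<open>0 < x\<close> \<open>x < lam\<close>
          by (intro DERIV_add DERIV_cmult erf_has_real_derivative
                DERIV_chain2[OF kirchhoff_has_real_derivative] deriv)
        then show ?thesis
          using flux[OF \<open>0 < x\<close> \<open>x < lam\<close>] by simp
      qed
    qed
    then show ?thesis
      using bc by (simp add: F_def C_def algebra_simps diff_divide_distrib)
  qed
  show ?thesis
    unfolding functional_problem_def
  proof (intro conjI ballI allI impI)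
    show "y \<eta> + \<delta> / (p + 1) * y \<eta> powr (p + 1)
        = sqrt pi / Ste * lam * exp (lam\<^sup>2) * (erf lam - erf \<eta>)" if "0 < \<eta> \<and> \<eta> < lam" for \<eta>
      using that integrated[of \<eta>] kirchhoff_of_nonneg[of "y \<eta>"] nonneg[of \<eta>] by auto
    show "lam * exp (lam\<^sup>2) * erf lam = Ste / sqrt pi * (1 + \<delta> / (p + 1))"
      using integrated[of 0] \<open>lam > 0\<close> \<open>Ste > 0\<close> bc
      by (simp only: kirchhoff_1) (simp add: field_simps)
  qed (use assms in auto)
qed

end

section \<open>The explicit similarity solution\<close>

locale stefan_problem = power_law \<delta> p for \<delta> p :: real +
  fixes \<rho> l k0 c0 T0 Tf a Ste :: real
  assumes pos: "\<rho> > 0" "l > 0" "k0 > 0" "c0 > 0" and Tf_less: "Tf < T0"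
    and a_eq: "a = sqrt (k0 / (\<rho> * c0))" and Ste_eq: "Ste = c0 * (T0 - Tf) / l"
begin

abbreviation k :: "real \<Rightarrow> real" where "k \<equiv> thermal_law k0 \<delta> p T0 Tf"
abbreviation c :: "real \<Rightarrow> real" where "c \<equiv> thermal_law c0 \<delta> p T0 Tf"

lemma a_pos: "a > 0"
  using pos by (simp add: a_eq)

lemma k0_eq: "k0 = \<rho> * c0 * a\<^sup>2"
  using pos by (simp add: a_eq)

lemma Ste_pos: "Ste > 0"
  using pos Tf_less by (simp add: Ste_eq)

lemma Ste_mult_l: "l * Ste = c0 * (T0 - Tf)"
  using pos by (simp add: Ste_eq)

lemma similarity_variable_time_derivative:
  assumes "t > 0"
  shows "((\<lambda>\<tau>. x / (2 * a * sqrt \<tau>)) has_real_derivative - (x / (4 * a * t * sqrt t))) (at t)"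
  using assms a_pos by (auto intro!: derivative_eq_intros simp: field_simps)

lemma free_boundary_derivative:
  assumes "t > 0"
  shows "((\<lambda>t. 2 * a * lam * sqrt t) has_real_derivative a * lam / sqrt t) (at t)"
  using assms by (auto intro!: derivative_eq_intros simp: field_simps)

lemma profile_start:
  assumes "lam * exp (lam\<^sup>2) * erf lam = Ste / sqrt pi * (1 + \<delta> / (p + 1))"
  shows "profile Ste lam 0 = 1"
proof -
  have "\<Psi> (profile Ste lam 0) = sqrt pi / Ste * (lam * exp (lam\<^sup>2) * erf lam)"
    by (simp add: profile_def)
  also have "\<dots> = \<Psi> 1"
    unfolding assms kirchhoff_1 using Ste_pos by simp
  finally show ?thesis
    by (metis inv_kirchhoff_kirchhoff)
qed

definition temperature :: "real \<Rightarrow> real \<Rightarrow> real \<Rightarrow> real" where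
  "temperature lam x t = (T0 - Tf) * profile Ste lam (x / (2 * a * sqrt t)) + Tf"

definition temperature_x :: "real \<Rightarrow> real \<Rightarrow> real \<Rightarrow> real" where
  "temperature_x lam x t =
     (T0 - Tf) * profile_slope Ste lam (x / (2 * a * sqrt t)) / (2 * a * sqrt t)"

definition temperature_t :: "real \<Rightarrow> real \<Rightarrow> real \<Rightarrow> real" where
  "temperature_t lam x t =
     (T0 - Tf) * profile_slope Ste lam (x / (2 * a * sqrt t)) * - (x / (4 * a * t * sqrt t))"

lemma temperature_has_x_derivative:
  "((\<lambda>\<xi>. temperature lam \<xi> t) has_real_derivative temperature_x lam x t) (at x within S)"
proof -
  have "((\<lambda>\<xi>. \<xi> / (2 * a * sqrt t)) has_real_derivative 1 / (2 * a * sqrt t)) (at x)"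
    by (rule DERIV_cdivide[OF DERIV_ident])
  from DERIV_chain2[OF profile_has_real_derivative[of Ste lam] this]
  have "((\<lambda>\<xi>. temperature lam \<xi> t) has_real_derivative temperature_x lam x t) (at x)"
    unfolding temperature_def temperature_x_def by (auto intro!: derivative_eq_intros)
  then show ?thesis
    by (rule has_field_derivative_at_within)
qed

lemma temperature_has_t_derivative:
  assumes "t > 0"
  shows "((\<lambda>\<tau>. temperature lam x \<tau>) has_real_derivative temperature_t lam x t) (at t)"
proof -
  from DERIV_chain2[OF profile_has_real_derivative[of Ste lam]
      similarity_variable_time_derivative[OF assms, of x]]
  show ?thesis
    unfolding temperature_def temperature_t_def by (auto intro!: derivative_eq_intros)
qed

lemma similarity_variable_le_iff:
  assumes "t > 0"
  shows "x / (2 * a * sqrt t) \<le> lam \<longleftrightarrow> x \<le> 2 * a * lam * sqrt t"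
    and "x / (2 * a * sqrt t) < lam \<longleftrightarrow> x < 2 * a * lam * sqrt t"
  using assms a_pos by (simp_all add: field_simps)

text \<open>The heat flux is an explicit multiple of $e^{-\eta^2}$, because $D(y)\,y'$ is;
this spares differentiating the conductivity and the slope of the profile separately. The
material laws are multiples of $D(y)$ because $y \ge 0$ up to the free boundary.\<close>

lemma flux_has_x_derivative:
  assumes lam: "lam > 0" and t: "t > 0" and x: "x < 2 * a * lam * sqrt t"
  shows "((\<lambda>\<xi>. k (temperature lam \<xi> t) * temperature_x lam \<xi> t) has_real_derivative
           \<rho> * c (temperature lam x t) * temperature_t lam x t) (at x)"
proof -
  define C where "C = 2 / Ste * lam * exp (lam\<^sup>2)"
  define E where "E = exp (- ((x / (2 * a * sqrt t))\<^sup>2))"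
  have nonneg: "profile Ste lam (\<xi> / (2 * a * sqrt t)) \<ge> 0" if "\<xi> < 2 * a * lam * sqrt t" for \<xi>
    using that similarity_variable_le_iff[OF t, of \<xi> lam] lam Ste_pos
    by (intro profile_nonneg) auto
  have flux: "D (profile Ste lam \<eta>) * profile_slope Ste lam \<eta> = - C * exp (- (\<eta>\<^sup>2))" for \<eta>
    by (simp add: profile_flux C_def)
  have "((\<lambda>\<xi>. k0 * (T0 - Tf) / (2 * a * sqrt t) * (- C * exp (- ((\<xi> / (2 * a * sqrt t))\<^sup>2))))
          has_real_derivative
            k0 * (T0 - Tf) / (2 * a * sqrt t)
              * (- C * (E * - (2 * (x / (2 * a * sqrt t)) * (1 / (2 * a * sqrt t)))))) (at x)"
  proof -
    have outer: "((\<lambda>\<eta>. exp (- (\<eta>\<^sup>2))) has_real_derivative exp (- (\<eta>\<^sup>2)) * - (2 * \<eta>)) (at \<eta>)"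
      for \<eta> :: real
      by (auto intro!: derivative_eq_intros)
    have inner: "((\<lambda>\<xi>. \<xi> / (2 * a * sqrt t)) has_real_derivative 1 / (2 * a * sqrt t)) (at x)"
      by (rule DERIV_cdivide[OF DERIV_ident])
    show ?thesis
      using DERIV_cmult[OF DERIV_cmult[OF DERIV_chain2[OF outer inner], of "- C"],
          of "k0 * (T0 - Tf) / (2 * a * sqrt t)"]
      by (simp add: E_def mult_ac)
  qed
  also have "k0 * (T0 - Tf) / (2 * a * sqrt t)
              * (- C * (E * - (2 * (x / (2 * a * sqrt t)) * (1 / (2 * a * sqrt t)))))
      = \<rho> * c0 * (T0 - Tf) * (- C * E) * - (x / (4 * a * t * sqrt t))"
  proof -
    obtain r where r: "r > 0" "t = r\<^sup>2"
      using t by (metis real_sqrt_gt_0_iff real_sqrt_pow2 less_imp_le)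
    then have "sqrt t = r"
      by simp
    then show ?thesis
      unfolding k0_eq using r a_pos by (simp add: divide_simps) (simp add: power2_eq_square)
  qed
  also have "\<dots> = \<rho> * c (temperature lam x t) * temperature_t lam x t"
    unfolding temperature_def temperature_t_def E_def flux[symmetric]
      thermal_law_conv_conductivity[OF Tf_less nonneg[OF x]]
    by (simp add: mult_ac)
  finally show ?thesis
  proof (rule has_field_derivative_transform_within_open[where S = "{..<2 * a * lam * sqrt t}"])
    fix \<xi> assume "\<xi> \<in> {..<2 * a * lam * sqrt t}"
    then have "\<xi> < 2 * a * lam * sqrt t"
      by simp
    then show "k0 * (T0 - Tf) / (2 * a * sqrt t) * (- C * exp (- ((\<xi> / (2 * a * sqrt t))\<^sup>2)))
        = k (temperature lam \<xi> t) * temperature_x lam \<xi> t"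
      unfolding temperature_def temperature_x_def flux[symmetric]
        thermal_law_conv_conductivity[OF Tf_less nonneg[OF \<open>\<xi> < 2 * a * lam * sqrt t\<close>]]
      by simp
  qed (use x in auto)
qed

text \<open>At the free boundary $D(y) = D(0) = 1$, so the slope of the profile there is exactly the flux
$-2\lambda/\mathrm{Ste}$.\<close>

lemma stefan_condition:
  assumes "t > 0"
  shows "k0 * temperature_x lam (2 * a * lam * sqrt t) t = - \<rho> * l * (a * lam / sqrt t)"
proof -
  have "profile_slope Ste lam lam = - (2 * lam / Ste)"
    by (simp add: profile_slope_def profile_end exp_minus)
  moreover have "2 * a * lam * sqrt t / (2 * a * sqrt t) = lam"
    using assms a_pos by simp
  ultimately have "k0 * temperature_x lam (2 * a * lam * sqrt t) t
      = \<rho> * c0 * a\<^sup>2 * ((T0 - Tf) * - (2 * lam / Ste) / (2 * a * sqrt t))"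
    by (simp only: temperature_x_def k0_eq[symmetric])
  also have "\<dots> = - (\<rho> * a * lam * (c0 * (T0 - Tf)) / (Ste * sqrt t))"
    using assms a_pos Ste_pos by (simp add: divide_simps) (simp add: power2_eq_square)
  also have "\<dots> = - \<rho> * l * (a * lam / sqrt t)"
    unfolding Ste_mult_l[symmetric] using Ste_pos by simp
  finally show ?thesis .
qed

lemma similarity_solution_temperature:
  assumes lam: "lam > 0"
    and lam_eq: "lam * exp (lam\<^sup>2) * erf lam = Ste / sqrt pi * (1 + \<delta> / (p + 1))"
  shows "similarity_solution \<rho> l k0 k c a T0 Tf (temperature lam) (\<lambda>t. 2 * a * lam * sqrt t)"
  unfolding similarity_solution_def
proof
  have cont: "continuous_on S (\<lambda>(x, t). temperature lam x t)"
      "continuous_on S (\<lambda>(x, t). temperature_x lam x t)"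
      "continuous_on S (\<lambda>(x, t). temperature_t lam x t)" if "\<And>x t. (x, t) \<in> S \<Longrightarrow> t > 0" for S
    unfolding temperature_def temperature_x_def temperature_t_def case_prod_unfold
    using that a_pos by (intro continuous_intros; fastforce)+
  show "stefan_solution \<rho> l k0 k c T0 Tf (temperature lam) (\<lambda>t. 2 * a * lam * sqrt t)"
    unfolding stefan_solution_def
  proof (intro conjI;
      (rule exI[of _ "temperature_t lam"], rule exI[of _ "temperature_x lam"],
       rule exI[of _ "\<lambda>t. a * lam / sqrt t"])?;
      (intro conjI allI impI)?)
    show "continuous_on {(x, t). 0 < t \<and> 0 \<le> x \<and> x \<le> 2 * a * lam * sqrt t} (\<lambda>(x, t). temperature lam x t)"
      "continuous_on {(x, t). 0 < t \<and> 0 < x \<and> x < 2 * a * lam * sqrt t} (\<lambda>(x, t). temperature_t lam x t)"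
      "continuous_on {(x, t). 0 < t \<and> 0 < x \<and> x \<le> 2 * a * lam * sqrt t} (\<lambda>(x, t). temperature_x lam x t)"
      by (rule cont; auto)+
    show "temperature lam 0 t = T0" for t
      by (simp add: temperature_def profile_start[OF lam_eq])
    show "temperature lam (2 * a * lam * sqrt t) t = Tf" if "t > 0" for t
      using that a_pos by (simp add: temperature_def profile_end)
  qed (use lam a_pos in \<open>auto intro!: continuous_intros free_boundary_derivative
        temperature_has_x_derivative temperature_has_t_derivative flux_has_x_derivative
        simp: stefan_condition\<close>)
  have "profile Ste lam \<eta> \<ge> 0" if "\<eta> \<in> {0..lam}" for \<eta>
    using that lam Ste_pos by (intro profile_nonneg) auto
  then show "similarity_form a T0 Tf (temperature lam) (\<lambda>t. 2 * a * lam * sqrt t)"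
    unfolding similarity_form_def
    by (intro exI[of _ lam] exI[of _ "profile Ste lam"]) (simp add: temperature_def lam)
qed

section \<open>Every similarity solution solves the functional problem\<close>

text \<open>At the time $t_0 = 1/(4a^2)$ the similarity variable equals $x$, so the profile and all its
properties are read off from the solution at this single time. The only information used from
other times is that $T$ depends on $x/(2a\sqrt t)$ alone and that $s(t) = 2a\lambda\sqrt t$. This
expresses $T_t$ and $s'$ at $t_0$ through $y'$ and $\lambda$, and makes the heat equation an
ordinary differential equation.\<close>

lemma similarity_solution_imp_functional_problem:
  assumes "similarity_solution \<rho> l k0 k c a T0 Tf T s"
  obtains y lam where "functional_problem Ste \<delta> p y lam"
    and "\<And>t. t > 0 \<Longrightarrow> s t = 2 * a * lam * sqrt t"
    and "\<And>t x. t > 0 \<Longrightarrow> x \<in> {0..s t} \<Longrightarrow> T x t = (T0 - Tf) * y (x / (2 * a * sqrt t)) + Tf"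
proof -
  from assms obtain lam y where lam: "lam > 0" and form:
      "\<forall>\<eta>\<in>{0..lam}. y \<eta> \<ge> 0"
      "\<forall>t>0. s t = 2 * a * lam * sqrt t"
      "\<forall>t>0. \<forall>x\<in>{0..s t}. T x t = (T0 - Tf) * y (x / (2 * a * sqrt t)) + Tf"
    unfolding similarity_solution_def similarity_form_def by (elim conjE exE) (rule that)
  note nonneg = form(1)[rule_format] and s = form(2)[rule_format] and T = form(3)[rule_format]
  from assms have cont_T: "continuous_on {(x, t). 0 < t \<and> 0 \<le> x \<and> x \<le> s t} (\<lambda>(x, t). T x t)"
    unfolding similarity_solution_def stefan_solution_def by (elim conjE)
  from assms obtain Tt Tx s' where
    cont_Tx: "continuous_on {(x, t). 0 < t \<and> 0 < x \<and> x \<le> s t} (\<lambda>(x, t). Tx x t)"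
    and equations: "\<forall>t>0.
        (s has_real_derivative s' t) (at t) \<and>
        (\<forall>x. 0 < x \<and> x \<le> s t \<longrightarrow>
           ((\<lambda>\<xi>. T \<xi> t) has_real_derivative Tx x t) (at x within {0..s t})) \<and>
        (\<forall>x. 0 < x \<and> x < s t \<longrightarrow>
           ((\<lambda>\<tau>. T x \<tau>) has_real_derivative Tt x t) (at t) \<and>
           ((\<lambda>\<xi>. k (T \<xi> t) * Tx \<xi> t) has_real_derivative \<rho> * c (T x t) * Tt x t) (at x)) \<and>
        T 0 t = T0 \<and> T (s t) t = Tf \<and> k0 * Tx (s t) t = - \<rho> * l * s' t"
    unfolding similarity_solution_def stefan_solution_def by (elim conjE exE) (rule that)
  define t0 where "t0 = 1 / (4 * a\<^sup>2)"
  have t0: "t0 > 0" and sqrt_t0: "sqrt t0 = 1 / (2 * a)"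
    using a_pos by (simp_all add: t0_def real_sqrt_divide real_sqrt_mult)
  have unit: "2 * a * sqrt t0 = 1"
    using a_pos by (simp add: sqrt_t0)
  have s_t0: "s t0 = lam"
    using s[OF t0] unit by (simp add: mult_ac)
  note at_t0 = equations[rule_format, OF t0, unfolded s_t0]
  have T_t0: "T \<eta> t0 = (T0 - Tf) * y \<eta> + Tf" if "\<eta> \<in> {0..lam}" for \<eta>
    using T[OF t0, of \<eta>] that by (simp add: s_t0 unit)
  define y1 where "y1 \<eta> = Tx \<eta> t0 / (T0 - Tf)" for \<eta>
  have Tx_t0: "Tx \<eta> t0 = (T0 - Tf) * y1 \<eta>" for \<eta>
    using Tf_less by (simp add: y1_def)
  have y_conv: "y \<eta> = (T \<eta> t0 - Tf) / (T0 - Tf)" if "\<eta> \<in> {0..lam}" for \<eta>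
    using T_t0[OF that] Tf_less by simp
  have deriv_y: "(y has_real_derivative y1 \<eta>) (at \<eta>)" if \<eta>: "0 < \<eta>" "\<eta> < lam" for \<eta>
  proof -
    have "at \<eta> within {0..lam} = at \<eta>"
      using \<eta> by (intro at_within_interior) (auto simp: interior_atLeastAtMost_real)
    moreover have "((\<lambda>\<xi>. T \<xi> t0) has_real_derivative Tx \<eta> t0) (at \<eta> within {0..lam})"
      using at_t0 \<eta> by simp
    ultimately have "((\<lambda>\<xi>. T \<xi> t0) has_real_derivative Tx \<eta> t0) (at \<eta>)"
      by simp
    then have "((\<lambda>\<xi>. (T \<xi> t0 - Tf) / (T0 - Tf)) has_real_derivative y1 \<eta>) (at \<eta>)"
      unfolding y1_def by (intro DERIV_cdivide) (auto intro!: derivative_eq_intros)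
    then show ?thesis
      by (rule has_field_derivative_transform_within_open[where S = "{0<..<lam}"])
         (use \<eta> y_conv in auto)
  qed
  have Tt_t0: "Tt \<eta> t0 = - 2 * a\<^sup>2 * \<eta> * ((T0 - Tf) * y1 \<eta>)" if \<eta>: "0 < \<eta>" "\<eta> < lam" for \<eta>
  proof -
    have "(y has_real_derivative y1 \<eta>) (at (\<eta> / (2 * a * sqrt t0)))"
      using deriv_y[OF \<eta>] by (simp add: unit)
    from DERIV_chain2[OF this similarity_variable_time_derivative[OF t0]]
    have "((\<lambda>\<tau>. (T0 - Tf) * y (\<eta> / (2 * a * sqrt \<tau>)) + Tf) has_real_derivative
            (T0 - Tf) * (y1 \<eta> * - (\<eta> / (4 * a * t0 * sqrt t0)))) (at t0)"
      by (auto intro!: derivative_eq_intros)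
    \<comment> \<open>The similarity form of $T(\eta, \tau)$ is given only while $\eta \le s(\tau)$; as
      $\eta < \lambda = s(t_0)$, this is the case for $\tau$ near $t_0$.\<close>
    then have "((\<lambda>\<tau>. T \<eta> \<tau>) has_real_derivative
            (T0 - Tf) * (y1 \<eta> * - (\<eta> / (4 * a * t0 * sqrt t0)))) (at t0)"
    proof (rule has_field_derivative_transform_within_open)
      show "open ({\<tau>. 0 < \<tau>} \<inter> {\<tau>. \<eta> < 2 * a * lam * sqrt \<tau>})"
        by (intro open_Int open_Collect_less continuous_intros)
      show "t0 \<in> {\<tau>. 0 < \<tau>} \<inter> {\<tau>. \<eta> < 2 * a * lam * sqrt \<tau>}"
        using t0 s[OF t0] s_t0 \<eta> by (metis (mono_tags, lifting) IntI mem_Collect_eq)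
      show "(T0 - Tf) * y (\<eta> / (2 * a * sqrt \<tau>)) + Tf = T \<eta> \<tau>"
        if "\<tau> \<in> {\<tau>. 0 < \<tau>} \<inter> {\<tau>. \<eta> < 2 * a * lam * sqrt \<tau>}" for \<tau>
        using T[of \<tau> \<eta>] s[of \<tau>] that \<eta> by simp
    qed
    moreover have "((\<lambda>\<tau>. T \<eta> \<tau>) has_real_derivative Tt \<eta> t0) (at t0)"
      using at_t0 \<eta> by simp
    ultimately have "Tt \<eta> t0 = (T0 - Tf) * (y1 \<eta> * - (\<eta> / (4 * a * t0 * sqrt t0)))"
      using DERIV_unique by blast
    also have "\<eta> / (4 * a * t0 * sqrt t0) = 2 * a\<^sup>2 * \<eta>"
      unfolding sqrt_t0 using a_pos by (simp add: t0_def field_simps power2_eq_square)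
    finally show ?thesis
      by (simp add: mult_ac)
  qed
  have "functional_problem Ste \<delta> p y lam"
  proof (rule free_boundary_ode_imp_functional_problem[OF Ste_pos lam nonneg _ _ deriv_y])
    show "continuous_on {0..lam} y"
    proof (rule continuous_on_eq)
      show "continuous_on {0..lam} (\<lambda>\<eta>. (T \<eta> t0 - Tf) / (T0 - Tf))"
        using Tf_less t0 s_t0
        by (intro continuous_intros continuous_on_compose2[OF cont_T, of _ "\<lambda>\<eta>. (\<eta>, t0)", simplified])
           auto
    qed (simp add: y_conv)
    show "continuous_on {0<..lam} y1"
      unfolding y1_def using Tf_less t0 s_t0
      by (intro continuous_intros continuous_on_compose2[OF cont_Tx, of _ "\<lambda>\<eta>. (\<eta>, t0)", simplified])
         auto
    show "((\<lambda>\<xi>. D (y \<xi>) * y1 \<xi>) has_real_derivative - 2 * \<eta> * (D (y \<eta>) * y1 \<eta>)) (at \<eta>)"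
      if \<eta>: "0 < \<eta>" "\<eta> < lam" for \<eta>
    proof -
      have law: "thermal_law r \<delta> p T0 Tf (T \<xi> t0) = r * D (y \<xi>)" if "\<xi> \<in> {0..lam}" for r \<xi>
        using thermal_law_conv_conductivity[OF Tf_less nonneg[OF that]] T_t0[OF that] by simp
      have "((\<lambda>\<xi>. k (T \<xi> t0) * Tx \<xi> t0 / (k0 * (T0 - Tf))) has_real_derivative
              \<rho> * c (T \<eta> t0) * Tt \<eta> t0 / (k0 * (T0 - Tf))) (at \<eta>)"
        using at_t0 \<eta> by (intro DERIV_cdivide) simp
      also have "\<rho> * c (T \<eta> t0) * Tt \<eta> t0 / (k0 * (T0 - Tf)) = - 2 * \<eta> * (D (y \<eta>) * y1 \<eta>)"
        using \<eta> pos Tf_less a_pos by (simp add: law Tt_t0 k0_eq)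
      finally show ?thesis
        by (rule has_field_derivative_transform_within_open[where S = "{0<..<lam}"])
           (use \<eta> pos Tf_less in \<open>auto simp: law Tx_t0\<close>)
    qed
    show "y 0 = 1" "y lam = 0"
      using y_conv[of 0] y_conv[of lam] at_t0 lam Tf_less by auto
    show "y1 lam = - 2 * lam / Ste"
    proof -
      have "(s has_real_derivative a * lam / sqrt t0) (at t0)"
        by (rule has_field_derivative_transform_within_open[OF free_boundary_derivative[OF t0], of "{0<..}"])
           (use t0 s in auto)
      moreover have "(s has_real_derivative s' t0) (at t0)" "k0 * Tx lam t0 = - \<rho> * l * s' t0"
        using at_t0 by simp_all
      ultimately have "k0 * Tx lam t0 = - \<rho> * l * (a * lam / sqrt t0)"
        using DERIV_unique by metis
      then have "\<rho> * c0 * a\<^sup>2 * ((T0 - Tf) * y1 lam) = - \<rho> * l * (2 * a\<^sup>2 * lam)"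
        unfolding Tx_t0 k0_eq[symmetric]
        by (simp add: sqrt_t0 power2_eq_square mult_ac)
      then have "(\<rho> * a\<^sup>2 * l) * (Ste * y1 lam) = (\<rho> * a\<^sup>2 * l) * (- 2 * lam)"
        using Ste_mult_l by algebra
      then have "Ste * y1 lam = - 2 * lam"
        using pos a_pos by (subst (asm) mult_left_cancel) auto
      then show ?thesis
        using Ste_pos by (simp add: field_simps)
    qed
  qed
  with s T show thesis
    by (intro that)
qed

end

section \<open>Existence and uniqueness\<close>

theorem theorem2p4:
  fixes \<rho> l k0 c0 T0 Tf \<delta> p a Ste :: real
    and k c :: "real \<Rightarrow> real"
  assumes "\<rho> > 0" and "l > 0" and "k0 > 0" and "c0 > 0"
    and "T0 > 0" and "Tf < T0" and "\<delta> \<ge> 0" and "p \<ge> 0"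
    and "k = thermal_law k0 \<delta> p T0 Tf" and "c = thermal_law c0 \<delta> p T0 Tf"
    and "k0 = k Tf" and "c0 = c Tf"
    and "a = sqrt (k0 / (\<rho> * c0))" and "Ste = c0 * (T0 - Tf) / l"
  shows "\<exists>y lam.
    functional_problem Ste \<delta> p y lam \<and>
    (\<forall>y' lam'. functional_problem Ste \<delta> p y' lam' \<longrightarrow>
       lam' = lam \<and> (\<forall>\<eta>. 0 < \<eta> \<and> \<eta> < lam \<longrightarrow> y' \<eta> = y \<eta>)) \<and>
    (\<exists>T s.
       similarity_solution \<rho> l k0 k c a T0 Tf T s \<and>
       (\<forall>t>0. s t = 2 * a * lam * sqrt t) \<and>
       (\<forall>t>0. \<forall>x. 0 < x \<and> x < s t \<longrightarrow>
          T x t = (T0 - Tf) * y (x / (2 * a * sqrt t)) + Tf) \<and>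
       (\<forall>T' s'. similarity_solution \<rho> l k0 k c a T0 Tf T' s' \<longrightarrow>
          (\<forall>t\<ge>0. s' t = s t) \<and>
          (\<forall>t>0. \<forall>x. 0 \<le> x \<and> x \<le> s t \<longrightarrow> T' x t = T x t)))"
proof -
  have p_0_imp: "\<delta> = 0" if "p = 0"
  proof -
    have "thermal_law k0 \<delta> p T0 Tf Tf = k0"
      using assms(9,11) by metis
    then show ?thesis
      using that \<open>k0 > 0\<close> by (simp add: thermal_law_def rpow_def)
  qed
  interpret stefan_problem \<delta> p \<rho> l k0 c0 T0 Tf a Ste
    by unfold_locales (use assms(1-8,13,14) p_0_imp in auto)
  have "Ste / sqrt pi * (1 + \<delta> / (p + 1)) > 0"
    using Ste_pos \<delta>_nonneg p_nonneg by (intro mult_pos_pos add_pos_nonneg) auto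
  then obtain lam where lam: "lam > 0"
      "lam * exp (lam\<^sup>2) * erf lam = Ste / sqrt pi * (1 + \<delta> / (p + 1))"
    using transcendental_unique_root by blast
  have fp: "functional_problem Ste \<delta> p (profile Ste lam) lam"
    by (rule functional_problem_profile[OF Ste_pos lam])
  have fp_unique: "lam' = lam \<and> (\<forall>\<eta>. 0 < \<eta> \<and> \<eta> < lam \<longrightarrow> y' \<eta> = profile Ste lam \<eta>)"
    if "functional_problem Ste \<delta> p y' lam'" for y' lam'
    using functional_problem_unique_lam[OF Ste_pos fp that] functional_problem_imp_profile[OF that]
    by auto
  define s where "s t = 2 * a * lam * sqrt t" for t
  have sol: "similarity_solution \<rho> l k0 k c a T0 Tf (temperature lam) s"
    unfolding s_def assms(9,10) by (rule similarity_solution_temperature[OF lam])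
  have unique: "(\<forall>t\<ge>0. s' t = s t) \<and> (\<forall>t>0. \<forall>x. 0 \<le> x \<and> x \<le> s t \<longrightarrow> T' x t = temperature lam x t)"
    if sol': "similarity_solution \<rho> l k0 k c a T0 Tf T' s'" for T' s'
  proof -
    obtain y' lam' where fp': "functional_problem Ste \<delta> p y' lam'"
      and s': "\<And>t. t > 0 \<Longrightarrow> s' t = 2 * a * lam' * sqrt t"
      and T': "\<And>t x. t > 0 \<Longrightarrow> x \<in> {0..s' t} \<Longrightarrow>
        T' x t = (T0 - Tf) * y' (x / (2 * a * sqrt t)) + Tf"
      by (rule similarity_solution_imp_functional_problem[OF sol'[unfolded assms(9,10)]]) (rule that)
    have "lam' = lam" and y': "\<And>\<eta>. 0 < \<eta> \<Longrightarrow> \<eta> < lam \<Longrightarrow> y' \<eta> = profile Ste lam \<eta>"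
      using fp_unique[OF fp'] by auto
    have s_eq: "s' t = s t" if "t > 0" for t
      using s'[OF that] by (simp add: s_def \<open>lam' = lam\<close>)
    have zero: "s' 0 = 0"
      using sol' by (simp add: similarity_solution_def stefan_solution_def)
    \<comment> \<open>The functional problem fixes $y$ only in the open interval $(0, \lambda)$; at its ends the
      boundary conditions of the Stefan problem give the temperature.\<close>
    have boundary: "U 0 t = T0 \<and> U (\<sigma> t) t = Tf"
      if "similarity_solution \<rho> l k0 k c a T0 Tf U \<sigma>" "t > 0" for U \<sigma> t
      using that by (auto simp: similarity_solution_def stefan_solution_def)
    have "T' x t = temperature lam x t" if t: "t > 0" and x: "0 \<le> x" "x \<le> s t" for x t
    proof -
      consider "x = 0" | "x = s t" | "0 < x" "x < s t"
        using x by linarith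
      then show ?thesis
      proof cases
        case 3
        then have "0 < x / (2 * a * sqrt t)" "x / (2 * a * sqrt t) < lam"
          using t a_pos similarity_variable_le_iff(2)[OF t, of x lam] by (simp_all add: s_def)
        then show ?thesis
          using T'[OF t, of x] 3 s_eq[OF t] by (simp add: y' temperature_def)
      qed (use boundary[OF sol' t] boundary[OF sol t] s_eq[OF t] in auto)
    qed
    moreover have "s' t = s t" if "t \<ge> 0" for t
      using that s_eq[of t] zero by (cases "t = 0") (auto simp: s_def)
    ultimately show ?thesis
      by blast
  qed
  show ?thesis
  proof (rule exI[of _ "profile Ste lam"], rule exI[of _ lam], intro conjI;
      (rule exI[of _ "temperature lam"], rule exI[of _ s], intro conjI)?)
    show "\<forall>y' lam'. functional_problem Ste \<delta> p y' lam' \<longrightarrow>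
        lam' = lam \<and> (\<forall>\<eta>. 0 < \<eta> \<and> \<eta> < lam \<longrightarrow> y' \<eta> = profile Ste lam \<eta>)"
      using fp_unique by blast
    show "\<forall>T' s'. similarity_solution \<rho> l k0 k c a T0 Tf T' s' \<longrightarrow>
        (\<forall>t\<ge>0. s' t = s t) \<and> (\<forall>t>0. \<forall>x. 0 \<le> x \<and> x \<le> s t \<longrightarrow> T' x t = temperature lam x t)"
      using unique by blast
  qed (use fp sol in \<open>auto simp: s_def temperature_def\<close>)
qed

end
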